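(* Let $M$ be a finite metric space with $\#M=n\ge2$, let $\sigma(M)=(\sigma_1,\ldots,\sigma_{n-1})$ be its $\mathrm{mst}$-spectrum and $\Sigma(M)=(\Sigma_1,\ldots,\Sigma_{n-1})$ its $\mathrm{xst}$-spectrum, and let $\lambda>0$. Then $$2d_{GH}(\lambda\Delta_n,M)=\max\{\lambda-\sigma_{n-1},\,\Sigma_{n-1}-\lambda\}=\max\{\lambda-\varepsilon(M),\,\operatorname{diam}M-\lambda\}.$$ More exactly, if $\sigma_{n-1}+\Sigma_{n-1}\le2\lambda$, then $2d_{GH}(\lambda\Delta_n,M)=\lambda-\sigma_{n-1}$; otherwise $2d_{GH}(\lambda\Delta_n,M)=\Sigma_{n-1}-\lambda$.
   Context: $\#M$ is the cardinality of $M$, $|xy|$ is the distance between points $x,y$, and $d_{GH}$ is the Gromov--Hausdorff distance. $\lambda\Delta_n$ denotes the $n$-point metric space (simplex) all of whose nonzero distances equal $\lambda$. $\varepsilon(M)=\inf\{|xy|:x,y\in M,\ x\ne y\}$. For a tree $G=(M,E)$ with vertex set $M$, the length of an edge $xy\in E$ is $|xy|$ and the length of $G$ is the sum of its edge lengths. A minimum (respectively maximum) spanning tree on $M$ is a tree with vertex set $M$ of smallest (respectively largest) length. The $\mathrm{mst}$-spectrum $\sigma(M)=(\sigma_1,\ldots,\sigma_{n-1})$ is the vector of edge lengths of any minimum spanning tree on $M$ in descending order; the $\mathrm{xst}$-spectrum $\Sigma(M)=(\Sigma_1,\ldots,\Sigma_{n-1})$ is the vector of edge lengths of any maximum spanning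 tree on $M$ in ascending order. Both are independent of the choice of tree. *)

theory Defs
  imports "HOL-Analysis.Analysis" "HOL-Library.Multiset"
begin

section \<open>The Gromov--Hausdorff distance\<close>

definition mnbhd :: "'a metric \<Rightarrow> real \<Rightarrow> 'a set \<Rightarrow> 'a set" where
  "mnbhd Z r A = (\<Union>a\<in>A. mball_of Z a r)"

text \<open>The next two quantities are real-valued, hence meaningful only for nonempty bounded sets
  (resp. spaces); otherwise the infimum may be taken over the empty set.\<close>

definition hausdorff_dist :: "'a metric \<Rightarrow> 'a set \<Rightarrow> 'a set \<Rightarrow> real" where
  "hausdorff_dist Z A B = Inf {r. r > 0 \<and> A \<subseteq> mnbhd Z r B \<and> B \<subseteq> mnbhd Z r A}"

definition isometric_embedding :: "'a metric \<Rightarrow> 'b metric \<Rightarrow> ('a \<Rightarrow> 'b) \<Rightarrow> bool" where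
  "isometric_embedding X Z f \<longleftrightarrow>
     f \<in> mspace X \<rightarrow> mspace Z \<and>
     (\<forall>x\<in>mspace X. \<forall>y\<in>mspace X. mdist Z (f x) (f y) = mdist X x y)"

text \<open>The infimum ranges over all metric spaces \<open>Z\<close> containing isometric copies of
  \<open>X\<close> and \<open>Y\<close>. Taking the points of \<open>Z\<close> from the sum type is no restriction: the Hausdorff distance
  does not change when \<open>Z\<close> is cut down to the union of the two copies, and that union
  injects into the sum type.\<close>

definition gh_dist :: "'a metric \<Rightarrow> 'b metric \<Rightarrow> real" where
  "gh_dist X Y =
     Inf {hausdorff_dist Z (f ` mspace X) (g ` mspace Y) | (Z :: ('a + 'b) metric) f g.
            isometric_embedding X Z f \<and> isometric_embedding Y Z g}"

section \<open>Simplices, smallest nonzero distance, diameter\<close>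

text \<open>For positive \<open>l\<close> only; otherwise this is not a metric and the value of \<^const>\<open>metric\<close> is unspecified.\<close>

definition simplex_metric :: "real \<Rightarrow> nat \<Rightarrow> nat metric" where
  "simplex_metric l n = metric ({..<n}, \<lambda>x y. if x = y then 0 else l)"

lemma Metric_space_simplex:
  assumes "l > 0"
  shows "Metric_space A (\<lambda>x y. if x = y then 0 else l)"
  using assms by unfold_locales auto

lemma mspace_simplex_metric [simp]: "l > 0 \<Longrightarrow> mspace (simplex_metric l n) = {..<n}"
  unfolding simplex_metric_def by (rule Metric_space.mspace_metric[OF Metric_space_simplex])

lemma mdist_simplex_metric [simp]:
  "l > 0 \<Longrightarrow> mdist (simplex_metric l n) = (\<lambda>x y. if x = y then 0 else l)"
  unfolding simplex_metric_def by (rule Metric_space.mdist_metric[OF Metric_space_simplex])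

definition min_separation :: "'a metric \<Rightarrow> real" where
  "min_separation M = Inf {mdist M x y | x y. x \<in> mspace M \<and> y \<in> mspace M \<and> x \<noteq> y}"

definition mdiameter :: "'a metric \<Rightarrow> real" where
  "mdiameter M = Sup {mdist M x y | x y. x \<in> mspace M \<and> y \<in> mspace M}"

section \<open>Spanning trees\<close>

text \<open>A simple undirected graph with vertex set \<open>V\<close> is given by its set of edges,
  which are two-element subsets of \<open>V\<close>.\<close>

definition simple_graph :: "'a set \<Rightarrow> 'a set set \<Rightarrow> bool" where
  "simple_graph V E \<longleftrightarrow> E \<subseteq> {{x, y} | x y. x \<in> V \<and> y \<in> V \<and> x \<noteq> y}"

definition graph_connected :: "'a set \<Rightarrow> 'a set set \<Rightarrow> bool" where
  "graph_connected V E \<longleftrightarrow> (\<forall>x\<in>V. \<forall>y\<in>V. (x, y) \<in> {(u, v). {u, v} \<in> E}\<^sup>*)"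

text \<open>A cycle is given by its list of vertices, in cyclic order.\<close>

definition graph_cycle :: "'a set set \<Rightarrow> 'a list \<Rightarrow> bool" where
  "graph_cycle E p \<longleftrightarrow>
     length p \<ge> 3 \<and> distinct p \<and>
     (\<forall>i<length p. {p ! i, p ! (Suc i mod length p)} \<in> E)"

definition tree_on :: "'a set \<Rightarrow> 'a set set \<Rightarrow> bool" where
  "tree_on V E \<longleftrightarrow> simple_graph V E \<and> graph_connected V E \<and> (\<nexists>p. graph_cycle E p)"

definition edge_length :: "'a metric \<Rightarrow> 'a set \<Rightarrow> real" where
  "edge_length M e = (THE r. \<exists>x y. e = {x, y} \<and> r = mdist M x y)"

lemma edge_length_eq [simp]: "edge_length M {x, y} = mdist M x y"
  unfolding edge_length_def
  by (rule the_equality) (auto simp: doubleton_eq_iff mdist_commute)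

definition graph_length :: "'a metric \<Rightarrow> 'a set set \<Rightarrow> real" where
  "graph_length M E = (\<Sum>e\<in>E. edge_length M e)"

definition minimum_spanning_tree :: "'a metric \<Rightarrow> 'a set set \<Rightarrow> bool" where
  "minimum_spanning_tree M E \<longleftrightarrow>
     tree_on (mspace M) E \<and>
     (\<forall>F. tree_on (mspace M) F \<longrightarrow> graph_length M E \<le> graph_length M F)"

definition maximum_spanning_tree :: "'a metric \<Rightarrow> 'a set set \<Rightarrow> bool" where
  "maximum_spanning_tree M E \<longleftrightarrow>
     tree_on (mspace M) E \<and>
     (\<forall>F. tree_on (mspace M) F \<longrightarrow> graph_length M F \<le> graph_length M E)"

text \<open>Edge lengths in ascending order, with multiplicity.\<close>

definition sorted_edge_lengths :: "'a metric \<Rightarrow> 'a set set \<Rightarrow> real list" where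
  "sorted_edge_lengths M E = sorted_list_of_multiset (image_mset (edge_length M) (mset_set E))"

text \<open>The spectra are rendered as relations: a list is a spectrum if it comes from some
  minimum (maximum) spanning tree. A statement about all spectra therefore covers
  every choice of the tree. Lists are indexed from 0, so the \<open>k\<close>-th entry of the
  vector is \<open>s ! (k - 1)\<close>.\<close>

definition is_mst_spectrum :: "'a metric \<Rightarrow> real list \<Rightarrow> bool" where
  "is_mst_spectrum M s \<longleftrightarrow>
     (\<exists>E. minimum_spanning_tree M E \<and> s = rev (sorted_edge_lengths M E))"

definition is_xst_spectrum :: "'a metric \<Rightarrow> real list \<Rightarrow> bool" where
  "is_xst_spectrum M s \<longleftrightarrow>
     (\<exists>E. maximum_spanning_tree M E \<and> s = sorted_edge_lengths M E)"

text \<open>Spectra exist for every nonempty finite space; a star is a spanning tree.\<close>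

lemma tree_on_star:
  assumes c: "c \<in> V"
  shows "tree_on V ((\<lambda>x. {c, x}) ` (V - {c}))" (is "tree_on V ?E")
proof -
  have "simple_graph V ?E"
    using c by (auto simp: simple_graph_def)
  moreover have "graph_connected V ?E"
  proof -
    let ?R = "{(u, v). {u, v} \<in> ?E}"
    have "(x, c) \<in> ?R\<^sup>*" "(c, x) \<in> ?R\<^sup>*" if "x \<in> V" for x
      by (cases "x = c"; use that in \<open>auto intro!: r_into_rtrancl simp: insert_commute\<close>)+
    then show ?thesis
      unfolding graph_connected_def by (meson rtrancl_trans)
  qed
  moreover have False if p: "graph_cycle ?E p" for p
  proof -
    have len: "length p \<ge> 3" and dist: "distinct p"
      and edge: "\<And>i. i < length p \<Longrightarrow> {p ! i, p ! (Suc i mod length p)} \<in> ?E"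
      using p by (auto simp: graph_cycle_def)
    have pne: "p \<noteq> []" using len by auto
    have hit: "c \<in> {p ! i, p ! (Suc i mod length p)}" if "i < length p" for i
      using edge[OF that] by blast
    have e0: "c = p ! 0 \<or> c = p ! 1" using hit[of 0] len by (cases p) auto
    have e1: "c = p ! 1 \<or> c = p ! 2" using hit[of 1] len by (auto simp: numeral_2_eq_2)
    have elast: "c = p ! (length p - 1) \<or> c = p ! 0"
      using hit[of "length p - 1"] len by (cases p) auto
    have ne: "p ! i \<noteq> p ! j" if "i < length p" "j < length p" "i \<noteq> j" for i j
      using that dist by (simp add: nth_eq_iff_index_eq)
    have "c \<noteq> p ! 0" using e1 ne[of 0 1] ne[of 0 2] len pne by auto
    then have "c = p ! 1" "c = p ! (length p - 1)" using e0 elast by blast+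
    moreover have "1 \<noteq> length p - 1" "1 < length p" "length p - 1 < length p" using len by arith+
    ultimately show False using ne[of 1 "length p - 1"] by metis
  qed
  ultimately show ?thesis unfolding tree_on_def by blast
qed

lemma finite_trees:
  assumes "finite V"
  shows "finite {E. tree_on V E}"
  by (rule finite_subset[of _ "Pow (Pow V)"])
     (use assms in \<open>auto simp: tree_on_def simple_graph_def\<close>)

lemma spectra_exist:
  assumes fin: "finite (mspace M)" and ne: "mspace M \<noteq> {}"
  shows "\<exists>s. is_mst_spectrum M s" "\<exists>s. is_xst_spectrum M s"
proof -
  let ?T = "{E. tree_on (mspace M) E}"
  have T: "finite ?T" "?T \<noteq> {}"
    using finite_trees[OF fin] tree_on_star[of _ "mspace M"] ne by blast+
  obtain E where "E \<in> ?T" "\<forall>F\<in>?T. graph_length M E \<le> graph_length M F"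
    using T
    by (metis (no_types, lifting) arg_min_if_finite(1) arg_min_least)
  then show "\<exists>s. is_mst_spectrum M s"
    by (auto simp: is_mst_spectrum_def minimum_spanning_tree_def)
  obtain F where "F \<in> ?T" "\<forall>E\<in>?T. - graph_length M F \<le> - graph_length M E"
    using T
    by (metis (no_types, lifting) arg_min_if_finite(1)[of ?T "\<lambda>E. - graph_length M E"]
        arg_min_least[of ?T _ "\<lambda>E. - graph_length M E"])
  then show "\<exists>s. is_xst_spectrum M s"
    by (auto simp: is_xst_spectrum_def maximum_spanning_tree_def)
qed

end

theory Submission
  imports Defs "HOL-Library.Transitive_Closure_Table"
begin

text \<open>Twice the Gromov--Hausdorff distance is the least distortion of a correspondence. Let
  \<open>\<epsilon>\<close> and \<open>d\<close> be the smallest and the largest distance between distinct points of \<open>M\<close>. A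
  bijection between the simplex and \<open>M\<close> compares every distance between distinct points of \<open>M\<close>
  with \<open>l\<close>, so its distortion is \<open>max (l - \<epsilon>) (d - l)\<close>. No other correspondence does better
  (\<open>max_deviation_le_of_correspondence\<close>): if two points of \<open>M\<close> share a partner, then, the two
  spaces having equally many points, some point of \<open>M\<close> has two partners. The first fact forces
  the distortion to be at least the distance of the two points, the second forces it to be
  at least \<open>l\<close>, and together they dominate the deviation of that distance from \<open>l\<close>.

  The spectra enter only through their last entries. If an edge \<open>{x, y}\<close> is added to a spanning
  tree, some other edge can be dropped so that a spanning tree remains (\<open>tree_exchange\<close>). In a
  minimum spanning tree the dropped edge cannot be longer than \<open>{x, y}\<close>, so the
  tree has an edge of length at most \<open>mdist M x y\<close>; hence its shortest edge realises \<open>\<epsilon>\<close>. Dually,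
  the longest edge of a maximum spanning tree realises \<open>d\<close>.\<close>

section \<open>Correspondences and the Gromov--Hausdorff distance\<close>

definition correspondence :: "'a metric \<Rightarrow> 'b metric \<Rightarrow> ('a \<times> 'b) set \<Rightarrow> bool" where
  "correspondence X Y R \<longleftrightarrow>
     R \<subseteq> mspace X \<times> mspace Y \<and>
     (\<forall>x\<in>mspace X. \<exists>y. (x, y) \<in> R) \<and> (\<forall>y\<in>mspace Y. \<exists>x. (x, y) \<in> R)"

text \<open>The length of a shortest route between the two spaces when the points paired by \<open>R\<close> are
  joined by bridges of length \<open>r\<close>.\<close>

definition bridge_dist ::
    "'a metric \<Rightarrow> 'b metric \<Rightarrow> ('a \<times> 'b) set \<Rightarrow> real \<Rightarrow> 'a \<Rightarrow> 'b \<Rightarrow> real" where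
  "bridge_dist X Y R r x y = (INF (a, b)\<in>R. mdist X x a + r + mdist Y b y)"

fun glue_dist ::
    "'a metric \<Rightarrow> 'b metric \<Rightarrow> ('a \<times> 'b) set \<Rightarrow> real \<Rightarrow> 'a + 'b \<Rightarrow> 'a + 'b \<Rightarrow> real" where
  "glue_dist X Y R r (Inl x) (Inl x') = mdist X x x'"
| "glue_dist X Y R r (Inr y) (Inr y') = mdist Y y y'"
| "glue_dist X Y R r (Inl x) (Inr y) = bridge_dist X Y R r x y"
| "glue_dist X Y R r (Inr y) (Inl x) = bridge_dist X Y R r x y"

lemma bridge_dist_le:
  assumes "0 \<le> r" and "(a, b) \<in> R"
  shows "bridge_dist X Y R r x y \<le> mdist X x a + r + mdist Y b y"
  unfolding bridge_dist_def
  by (rule cINF_lower2[OF _ assms(2)]) (use assms(1) in \<open>auto intro!: bdd_belowI2[of _ 0]\<close>)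

lemma bridge_dist_ge:
  assumes "R \<noteq> {}" and "\<And>a b. (a, b) \<in> R \<Longrightarrow> z \<le> mdist X x a + r + mdist Y b y"
  shows "z \<le> bridge_dist X Y R r x y"
  unfolding bridge_dist_def by (rule cINF_greatest) (use assms in auto)

text \<open>A detour through the other space, from \<open>x\<close> to \<open>x'\<close> via \<open>y\<close>, uses two bridges and so pays
  \<open>2 * r\<close>; the distortion bound says exactly that travelling in the other space saves no more
  than this. This gives the triangle inequality where the middle point lies in the other space;
  in the remaining cases it is inherited from the two given metrics. Positivity of \<open>r\<close> keeps
  points of different spaces apart.\<close>

lemma Metric_space_glue_dist:
  assumes R: "R \<subseteq> mspace X \<times> mspace Y" "R \<noteq> {}" and r: "0 < r"
    and dist: "\<And>x y x' y'. (x, y) \<in> R \<Longrightarrow> (x', y') \<in> R \<Longrightarrow>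
                 \<bar>mdist X x x' - mdist Y y y'\<bar> \<le> 2 * r"
  shows "Metric_space (mspace X <+> mspace Y) (glue_dist X Y R r)"
proof -
  let ?c = "bridge_dist X Y R r"
  have le: "?c x y \<le> mdist X x a + r + mdist Y b y" if "(a, b) \<in> R" for a b x y
    using bridge_dist_le[of r] r that by force
  have pos: "0 < ?c x y" for x y
    using bridge_dist_ge[OF R(2), of r X x r Y y] r by force
  have tri1: "?c x y \<le> mdist X x x' + ?c x' y" if "x \<in> mspace X" "x' \<in> mspace X" for x x' y
  proof -
    have "?c x y - mdist X x x' \<le> ?c x' y"
    proof (rule bridge_dist_ge[OF R(2)])
      fix a b assume "(a, b) \<in> R"
      then show "?c x y - mdist X x x' \<le> mdist X x' a + r + mdist Y b y"
        using le[of a b x y] mdist_triangle[of x X x' a] that R(1) by force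
    qed
    then show ?thesis by simp
  qed
  have tri2: "?c x y \<le> ?c x y' + mdist Y y' y" if "y \<in> mspace Y" "y' \<in> mspace Y" for x y y'
  proof -
    have "?c x y - mdist Y y' y \<le> ?c x y'"
    proof (rule bridge_dist_ge[OF R(2)])
      fix a b assume "(a, b) \<in> R"
      then show "?c x y - mdist Y y' y \<le> mdist X x a + r + mdist Y b y'"
        using le[of a b x y] mdist_triangle[of b Y y' y] that R(1) by force
    qed
    then show ?thesis by simp
  qed
  have tri3: "mdist X x x' \<le> ?c x y + ?c x' y"
    if "x \<in> mspace X" "x' \<in> mspace X" "y \<in> mspace Y" for x x' y
  proof -
    have "mdist X x x' - ?c x' y \<le> ?c x y"
    proof (rule bridge_dist_ge[OF R(2)])
      fix a b assume ab: "(a, b) \<in> R"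
      have "mdist X x x' - (mdist X x a + r + mdist Y b y) \<le> ?c x' y"
      proof (rule bridge_dist_ge[OF R(2)])
        fix a' b' assume ab': "(a', b') \<in> R"
        have "mdist X x x' \<le> mdist X x a + mdist X a a' + mdist X x' a'"
          using mdist_triangle[of x X a x'] mdist_triangle[of a X a' x']
            mdist_commute[of X x' a'] that ab ab' R(1) by force
        moreover have "mdist Y b b' \<le> mdist Y b y + mdist Y b' y"
          using mdist_triangle[of b Y y b'] mdist_commute[of Y b' y] that ab ab' R(1) by force
        ultimately show "mdist X x x' - (mdist X x a + r + mdist Y b y)
            \<le> mdist X x' a' + r + mdist Y b' y"
          using dist[OF ab ab'] by linarith
      qed
      then show "mdist X x x' - ?c x' y \<le> mdist X x a + r + mdist Y b y" by simp
    qed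
    then show ?thesis by simp
  qed
  have tri4: "mdist Y y y' \<le> ?c x y + ?c x y'"
    if "y \<in> mspace Y" "y' \<in> mspace Y" "x \<in> mspace X" for x y y'
  proof -
    have "mdist Y y y' - ?c x y' \<le> ?c x y"
    proof (rule bridge_dist_ge[OF R(2)])
      fix a b assume ab: "(a, b) \<in> R"
      have "mdist Y y y' - (mdist X x a + r + mdist Y b y) \<le> ?c x y'"
      proof (rule bridge_dist_ge[OF R(2)])
        fix a' b' assume ab': "(a', b') \<in> R"
        have "mdist Y y y' \<le> mdist Y b y + mdist Y b b' + mdist Y b' y'"
          using mdist_triangle[of y Y b y'] mdist_triangle[of b Y b' y']
            mdist_commute[of Y b y] that ab ab' R(1) by force
        moreover have "mdist X a a' \<le> mdist X x a + mdist X x a'"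
          using mdist_triangle[of a X x a'] mdist_commute[of X a x] that ab ab' R(1) by force
        ultimately show "mdist Y y y' - (mdist X x a + r + mdist Y b y)
            \<le> mdist X x a' + r + mdist Y b' y'"
          using dist[OF ab ab'] by linarith
      qed
      then show "mdist Y y y' - ?c x y' \<le> mdist X x a + r + mdist Y b y" by simp
    qed
    then show ?thesis by simp
  qed
  show ?thesis
  proof
    fix p q
    show "0 \<le> glue_dist X Y R r p q"
      by (cases p; cases q) (auto intro: less_imp_le[OF pos])
    show "glue_dist X Y R r p q = glue_dist X Y R r q p"
      by (cases p; cases q) (auto simp: mdist_commute)
    show "(glue_dist X Y R r p q = 0) = (p = q)"
      if "p \<in> mspace X <+> mspace Y" "q \<in> mspace X <+> mspace Y"
      using that by (cases p; cases q) (auto simp: pos[THEN less_imp_neq, symmetric])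
    show "glue_dist X Y R r p s \<le> glue_dist X Y R r p q + glue_dist X Y R r q s"
      if "p \<in> mspace X <+> mspace Y" "q \<in> mspace X <+> mspace Y" "s \<in> mspace X <+> mspace Y"
      for s
    proof (cases p; cases q; cases s)
      fix x x' x'' assume "p = Inl x" "q = Inl x'" "s = Inl x''"
      then show ?thesis using that by (auto intro: mdist_triangle)
    next
      fix x x' y assume "p = Inl x" "q = Inl x'" "s = Inr y"
      then show ?thesis using that by (auto intro: tri1)
    next
      fix x y x' assume "p = Inl x" "q = Inr y" "s = Inl x'"
      then show ?thesis using that by (auto intro: tri3)
    next
      fix x y y' assume "p = Inl x" "q = Inr y" "s = Inr y'"
      then show ?thesis using that by (auto intro: tri2)
    next
      fix y x x' assume "p = Inr y" "q = Inl x" "s = Inl x'"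
      then show ?thesis using that tri1[of x' x y] mdist_commute[of X x x'] by auto
    next
      fix y x y' assume "p = Inr y" "q = Inl x" "s = Inr y'"
      then show ?thesis using that by (auto intro: tri4)
    next
      fix y y' x assume "p = Inr y" "q = Inr y'" "s = Inl x"
      then show ?thesis using that tri2[of y y' x] mdist_commute[of Y y y'] by auto
    next
      fix y y' y'' assume "p = Inr y" "q = Inr y'" "s = Inr y''"
      then show ?thesis using that by (auto intro: mdist_triangle)
    qed
  qed
qed

text \<open>In the glued space paired points are at distance at most \<open>r\<close>, so each copy lies in every
  open neighbourhood of the other of radius larger than \<open>r\<close>.\<close>

lemma ex_common_space_hausdorff_dist_le:
  assumes R: "correspondence X Y R" "R \<noteq> {}" and r: "0 < r"
    and dist: "\<And>x y x' y'. (x, y) \<in> R \<Longrightarrow> (x', y') \<in> R \<Longrightarrow>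
                 \<bar>mdist X x x' - mdist Y y y'\<bar> \<le> 2 * r"
  shows "\<exists>(Z :: ('a + 'b) metric) f g. isometric_embedding X Z f \<and> isometric_embedding Y Z g \<and>
           hausdorff_dist Z (f ` mspace (X :: 'a metric)) (g ` mspace (Y :: 'b metric)) \<le> r"
proof -
  define Z where "Z = metric (mspace X <+> mspace Y, glue_dist X Y R r)"
  have R': "R \<subseteq> mspace X \<times> mspace Y" using R(1) by (simp add: correspondence_def)
  interpret G: Metric_space "mspace X <+> mspace Y" "glue_dist X Y R r"
    by (rule Metric_space_glue_dist[OF R' R(2) r dist])
  have Z [simp]: "mspace Z = mspace X <+> mspace Y" "mdist Z = glue_dist X Y R r"
    by (simp_all add: Z_def)
  have near: "glue_dist X Y R r (Inl x) (Inr y) < s" if "(x, y) \<in> R" "r < s" for x y s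
  proof -
    have "mdist X x x = 0" "mdist Y y y = 0" using that(1) R' by auto
    then show ?thesis using bridge_dist_le[of r x y R X Y x y] that r by simp
  qed
  have "s \<in> {s. s > 0 \<and> Inl ` mspace X \<subseteq> mnbhd Z s (Inr ` mspace Y) \<and>
                Inr ` mspace Y \<subseteq> mnbhd Z s (Inl ` mspace X)}" if s: "r < s" for s
  proof -
    have "\<exists>y\<in>mspace Y. Inl x \<in> mball_of Z (Inr y) s" if x: "x \<in> mspace X" for x
    proof -
      obtain y where "(x, y) \<in> R" using R(1) x by (auto simp: correspondence_def)
      then show ?thesis using near[OF _ s] R' by (auto simp: in_mball_of)
    qed
    moreover have "\<exists>x\<in>mspace X. Inr y \<in> mball_of Z (Inl x) s" if y: "y \<in> mspace Y" for y
    proof -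
      obtain x where "(x, y) \<in> R" using R(1) y by (auto simp: correspondence_def)
      then show ?thesis using near[OF _ s] R' by (auto simp: in_mball_of)
    qed
    ultimately show ?thesis using r s by (auto simp: mnbhd_def)
  qed
  then have "hausdorff_dist Z (Inl ` mspace X) (Inr ` mspace Y) \<le> s" if "r < s" for s
    unfolding hausdorff_dist_def using that
    by (intro cInf_lower) (auto intro!: bdd_belowI[of _ 0])
  then have "hausdorff_dist Z (Inl ` mspace X) (Inr ` mspace Y) \<le> r"
    by (meson dense_ge)
  moreover have "isometric_embedding X Z Inl" "isometric_embedding Y Z Inr"
    by (auto simp: isometric_embedding_def)
  ultimately show ?thesis by blast
qed

lemma finite_mnbhd_cover:
  assumes "finite A" "finite B" "B \<noteq> {}" "A \<subseteq> mspace Z" "B \<subseteq> mspace Z"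
  shows "\<exists>r0. \<forall>r>r0. A \<subseteq> mnbhd Z r B"
proof -
  obtain b where b: "b \<in> B" using assms(3) by blast
  have "A \<subseteq> mnbhd Z r B" if "Max (insert 0 (mdist Z b ` A)) < r" for r
  proof
    fix a assume a: "a \<in> A"
    then have "mdist Z b a < r" using that assms(1) by auto
    then show "a \<in> mnbhd Z r B"
      using a b assms(4,5) by (auto simp: mnbhd_def in_mball_of intro!: bexI[of _ b])
  qed
  then show ?thesis by blast
qed

text \<open>Finiteness guarantees that some radius is admissible, so that the infimum defining the
  Hausdorff distance is not taken over the empty set.\<close>

lemma hausdorff_dist_ge:
  assumes "finite A" "finite B" "A \<noteq> {}" "B \<noteq> {}" "A \<subseteq> mspace Z" "B \<subseteq> mspace Z"
    and "\<And>r. 0 < r \<Longrightarrow> A \<subseteq> mnbhd Z r B \<Longrightarrow> B \<subseteq> mnbhd Z r A \<Longrightarrow> c \<le> r"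
  shows "c \<le> hausdorff_dist Z A B"
proof -
  obtain r1 r2 where r: "\<forall>r>r1. A \<subseteq> mnbhd Z r B" "\<forall>r>r2. B \<subseteq> mnbhd Z r A"
    using finite_mnbhd_cover[of A B Z] finite_mnbhd_cover[of B A Z] assms by blast
  have "1 + max 0 (max r1 r2) \<in> {r. r > 0 \<and> A \<subseteq> mnbhd Z r B \<and> B \<subseteq> mnbhd Z r A}"
    using r by simp
  then show ?thesis
    unfolding hausdorff_dist_def by (intro cInf_greatest) (use assms(7) in blast)+
qed

text \<open>Pairing points at distance less than \<open>r\<close> in the common space gives the correspondence: two
  pairs change a distance by less than \<open>r\<close> at each end.\<close>

lemma correspondence_of_mnbhd:
  assumes f: "isometric_embedding X Z f" and g: "isometric_embedding Y Z g"
    and X: "f ` mspace X \<subseteq> mnbhd Z r (g ` mspace Y)"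
    and Y: "g ` mspace Y \<subseteq> mnbhd Z r (f ` mspace X)"
  shows "\<exists>R. correspondence X Y R \<and>
           (\<forall>x y x' y'. (x, y) \<in> R \<longrightarrow> (x', y') \<in> R \<longrightarrow>
              \<bar>mdist X x x' - mdist Y y y'\<bar> < 2 * r)"
proof -
  define R where "R = {(x, y). x \<in> mspace X \<and> y \<in> mspace Y \<and> mdist Z (f x) (g y) < r}"
  have "\<exists>y. (x, y) \<in> R" if x: "x \<in> mspace X" for x
  proof -
    have "f x \<in> mnbhd Z r (g ` mspace Y)" using X x by blast
    then show ?thesis using x by (auto simp: R_def mnbhd_def in_mball_of mdist_commute[of Z "f x"])
  qed
  moreover have "\<exists>x. (x, y) \<in> R" if y: "y \<in> mspace Y" for y
  proof -
    have "g y \<in> mnbhd Z r (f ` mspace X)" using Y y by blast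
    then show ?thesis using y by (auto simp: R_def mnbhd_def in_mball_of)
  qed
  ultimately have "correspondence X Y R"
    by (auto simp: correspondence_def R_def)
  moreover have "\<bar>mdist X x x' - mdist Y y y'\<bar> < 2 * r"
    if "(x, y) \<in> R" "(x', y') \<in> R" for x y x' y'
  proof -
    have Z: "f x \<in> mspace Z" "f x' \<in> mspace Z" "g y \<in> mspace Z" "g y' \<in> mspace Z"
      and [symmetric]: "mdist Z (f x) (f x') = mdist X x x'" "mdist Z (g y) (g y') = mdist Y y y'"
      and "mdist Z (f x) (g y) < r" "mdist Z (f x') (g y') < r"
      using f g that by (auto simp: isometric_embedding_def R_def)
    moreover have "mdist Z (f x) (f x') \<le>
        mdist Z (f x) (g y) + mdist Z (g y) (g y') + mdist Z (f x') (g y')"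
      using mdist_triangle[of "f x" Z "g y" "f x'"] mdist_triangle[of "g y" Z "g y'" "f x'"]
        mdist_commute[of Z "f x'" "g y'"] Z by linarith
    moreover have "mdist Z (g y) (g y') \<le>
        mdist Z (f x) (g y) + mdist Z (f x) (f x') + mdist Z (f x') (g y')"
      using mdist_triangle[of "g y" Z "f x" "g y'"] mdist_triangle[of "f x" Z "f x'" "g y'"]
        mdist_commute[of Z "f x" "g y"] Z by linarith
    ultimately show ?thesis by linarith
  qed
  ultimately show ?thesis by blast
qed

lemma hausdorff_dist_embeddings_ge:
  assumes "finite (mspace X)" "finite (mspace Y)" "mspace X \<noteq> {}" "mspace Y \<noteq> {}"
    and "isometric_embedding X Z f" "isometric_embedding Y Z g"
    and c: "\<And>R r. correspondence X Y R \<Longrightarrow>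
              (\<And>x y x' y'. (x, y) \<in> R \<Longrightarrow> (x', y') \<in> R \<Longrightarrow>
                 \<bar>mdist X x x' - mdist Y y y'\<bar> < 2 * r) \<Longrightarrow> c \<le> r"
  shows "c \<le> hausdorff_dist Z (f ` mspace X) (g ` mspace Y)"
proof (rule hausdorff_dist_ge)
  fix r assume "f ` mspace X \<subseteq> mnbhd Z r (g ` mspace Y)" "g ` mspace Y \<subseteq> mnbhd Z r (f ` mspace X)"
  from correspondence_of_mnbhd[OF assms(5,6) this] show "c \<le> r" using c by blast
qed (use assms in \<open>auto simp: isometric_embedding_def\<close>)

text \<open>The full relation, glued with a large enough \<open>r\<close>, provides one common ambient space; hence
  the infimum runs over a nonempty set, and every lower bound of that set carries over to it.\<close>

lemma gh_dist_ge:
  fixes X :: "'a metric" and Y :: "'b metric"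
  assumes fin: "finite (mspace X)" "finite (mspace Y)" and ne: "mspace X \<noteq> {}" "mspace Y \<noteq> {}"
    and c: "\<And>R r. correspondence X Y R \<Longrightarrow>
              (\<And>x y x' y'. (x, y) \<in> R \<Longrightarrow> (x', y') \<in> R \<Longrightarrow>
                 \<bar>mdist X x x' - mdist Y y y'\<bar> < 2 * r) \<Longrightarrow> c \<le> r"
  shows "c \<le> gh_dist X Y"
proof -
  let ?R = "mspace X \<times> mspace Y"
  let ?D = "(\<lambda>((x, y), (x', y')). \<bar>mdist X x x' - mdist Y y y'\<bar>) ` (?R \<times> ?R)"
  have R: "correspondence X Y ?R" "?R \<noteq> {}"
    using ne by (auto simp: correspondence_def)
  have "\<bar>mdist X x x' - mdist Y y y'\<bar> \<le> 2 * Max (insert 1 ?D)"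
    if "(x, y) \<in> ?R" "(x', y') \<in> ?R" for x y x' y'
  proof -
    have *: "finite (insert 1 ?D)" using fin by simp
    have "\<bar>mdist X x x' - mdist Y y y'\<bar> \<in> insert 1 ?D" using that by force
    from Max_ge[OF * this] Max_ge[OF *, of 1] show ?thesis by simp
  qed
  moreover have "0 < Max (insert 1 ?D)"
    by (rule less_le_trans[OF zero_less_one Max_ge]) (use fin in simp_all)
  ultimately obtain Z :: "('a + 'b) metric" and f g
    where "isometric_embedding X Z f" "isometric_embedding Y Z g"
    using ex_common_space_hausdorff_dist_le[OF R] by blast
  then show ?thesis
    unfolding gh_dist_def
    by (intro cInf_greatest)
       (use hausdorff_dist_embeddings_ge[OF fin ne] c in blast)+
qed

text \<open>The gluing needs bridges of positive length, hence radii \<open>s > r\<close> are used and \<open>r = 0\<close> is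
  reached in the limit.\<close>

lemma gh_dist_le:
  fixes X :: "'a metric" and Y :: "'b metric"
  assumes fin: "finite (mspace X)" "finite (mspace Y)" and ne: "mspace X \<noteq> {}" "mspace Y \<noteq> {}"
    and R: "correspondence X Y R" and r: "0 \<le> r"
    and dist: "\<And>x y x' y'. (x, y) \<in> R \<Longrightarrow> (x', y') \<in> R \<Longrightarrow>
                 \<bar>mdist X x x' - mdist Y y y'\<bar> \<le> 2 * r"
  shows "gh_dist X Y \<le> r"
proof (rule dense_ge)
  fix s assume s: "r < s"
  have nonneg: "0 \<le> hausdorff_dist Z (f ` mspace X) (g ` mspace Y)"
    if "isometric_embedding X Z f" "isometric_embedding Y Z g" for Z :: "('a + 'b) metric" and f g
  proof (rule hausdorff_dist_embeddings_ge[OF fin ne that])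
    fix R r assume "correspondence X Y R" and
      *: "\<And>x y x' y'. (x, y) \<in> R \<Longrightarrow> (x', y') \<in> R \<Longrightarrow> \<bar>mdist X x x' - mdist Y y y'\<bar> < 2 * r"
    then obtain x y where "(x, y) \<in> R" using ne unfolding correspondence_def by blast
    from *[OF this this] show "0 \<le> r" by simp
  qed
  have "R \<noteq> {}" using R ne by (auto simp: correspondence_def)
  moreover have "\<bar>mdist X x x' - mdist Y y y'\<bar> \<le> 2 * s"
    if "(x, y) \<in> R" "(x', y') \<in> R" for x y x' y'
    using dist[OF that] s by linarith
  ultimately obtain Z :: "('a + 'b) metric" and f g
    where Z: "isometric_embedding X Z f" "isometric_embedding Y Z g"
      "hausdorff_dist Z (f ` mspace X) (g ` mspace Y) \<le> s"
    using ex_common_space_hausdorff_dist_le[OF R, of s] r s by force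
  have "gh_dist X Y \<le> hausdorff_dist Z (f ` mspace X) (g ` mspace Y)"
    unfolding gh_dist_def
    by (rule cInf_lower) (use Z in blast, use nonneg in \<open>auto intro!: bdd_belowI[of _ 0]\<close>)
  with Z(3) show "gh_dist X Y \<le> s" by simp
qed

section \<open>Distance to a simplex with the same number of points\<close>

text \<open>If \<open>x\<close> and \<open>y\<close> have different partners, the bound is the distortion of these two pairs.
  Otherwise they share a partner \<open>i\<close>, and \<open>mdist M x y < 2 * r\<close>. By counting, a choice of partners
  that sends both to \<open>i\<close> misses some \<open>k\<close>; a point paired with \<open>k\<close> then has two partners, so
  \<open>l < 2 * r\<close>. Both numbers being positive, their difference is bounded as well.\<close>

lemma max_deviation_le_of_correspondence:
  assumes l: "0 < l" and fin: "finite (mspace M)" and card: "card (mspace M) = n"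
    and R: "correspondence (simplex_metric l n) M R"
    and dist: "\<And>i m j m'. (i, m) \<in> R \<Longrightarrow> (j, m') \<in> R \<Longrightarrow>
                 \<bar>mdist (simplex_metric l n) i j - mdist M m m'\<bar> < 2 * r"
    and x: "x \<in> mspace M" and y: "y \<in> mspace M" and xy: "x \<noteq> y"
  shows "\<bar>l - mdist M x y\<bar> < 2 * r"
proof -
  have R': "R \<subseteq> {..<n} \<times> mspace M" "\<And>i. i < n \<Longrightarrow> \<exists>m. (i, m) \<in> R"
    "\<And>m. m \<in> mspace M \<Longrightarrow> \<exists>i. (i, m) \<in> R"
    using R l by (auto simp: correspondence_def)
  obtain i j where ij: "(i, x) \<in> R" "(j, y) \<in> R" using R'(3) x y by blast
  show ?thesis
  proof (cases "i = j")
    case False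
    then show ?thesis using dist[OF ij] l by simp
  next
    case True
    have d: "mdist M x y < 2 * r" "0 < mdist M x y"
      using dist[OF ij] True l Metric_space.mdist_pos_less[OF Metric_space_mspace_mdist xy x y]
      by auto
    obtain h where h: "\<And>m. m \<in> mspace M \<Longrightarrow> (h m, m) \<in> R"
      using R'(3) by metis
    \<comment> \<open>The choice of partners is forced to be non-injective, hence it is not onto.\<close>
    define h' where "h' = h(x := i, y := i)"
    have h': "(h' m, m) \<in> R" if "m \<in> mspace M" for m
      using h that ij True by (auto simp: h'_def)
    have "h' ` mspace M \<noteq> {..<n}"
    proof
      assume "h' ` mspace M = {..<n}"
      then have "inj_on h' (mspace M)"
        using fin card by (intro eq_card_imp_inj_on) auto
      then show False using x y xy by (auto simp: h'_def inj_on_def)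
    qed
    moreover have "h' ` mspace M \<subseteq> {..<n}" using h' R'(1) by blast
    ultimately obtain k where k: "k < n" "k \<notin> h' ` mspace M" by blast
    then obtain m where m: "(k, m) \<in> R" using R'(2) by blast
    then have "m \<in> mspace M" using R'(1) by blast
    then have "(h' m, m) \<in> R" "k \<noteq> h' m" using h' k by auto
    moreover have "mdist M m m = 0" using \<open>m \<in> mspace M\<close> by simp
    ultimately have "l < 2 * r" using dist[OF m, of "h' m" m] l by auto
    with d show ?thesis using l by linarith
  qed
qed

text \<open>The bounds \<open>s\<close> and \<open>t\<close> are attained, so any bijection has the stated distortion and the
  preceding lemma, applied to the extremal pairs, shows that it is optimal.\<close>

lemma gh_dist_simplex_eq:
  fixes M :: "'a metric"
  assumes fin: "finite (mspace M)" and card: "card (mspace M) = n" and l: "0 < l"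
    and lo: "\<And>x y. x \<in> mspace M \<Longrightarrow> y \<in> mspace M \<Longrightarrow> x \<noteq> y \<Longrightarrow> s \<le> mdist M x y"
    and hi: "\<And>x y. x \<in> mspace M \<Longrightarrow> y \<in> mspace M \<Longrightarrow> mdist M x y \<le> t"
    and s: "a \<in> mspace M" "b \<in> mspace M" "a \<noteq> b" "mdist M a b = s"
    and t: "c \<in> mspace M" "d \<in> mspace M" "c \<noteq> d" "mdist M c d = t"
  shows "2 * gh_dist (simplex_metric l n) M = max (l - s) (t - l)"
proof (rule antisym)
  let ?S = "simplex_metric l n"
  have "0 < n" using s(1) fin card by (auto simp: card_gt_0_iff)
  then have S: "finite (mspace ?S)" "mspace ?S \<noteq> {}" "mspace M \<noteq> {}"
    using l s(1) by (auto simp: lessThan_empty_iff)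
  obtain h where h: "bij_betw h {..<n} (mspace M)"
    using ex_bij_betw_nat_finite[OF fin] card by (auto simp: atLeast0LessThan)
  have st: "s \<le> t" using lo[OF t(1,2,3)] t(4) by simp
  have "gh_dist ?S M \<le> max (l - s) (t - l) / 2"
  proof (rule gh_dist_le[OF S(1) fin S(2,3)])
    show "correspondence ?S M ((\<lambda>i. (i, h i)) ` {..<n})"
      unfolding correspondence_def mspace_simplex_metric[OF l] using bij_betw_imp_surj_on[OF h]
      by blast
    show "0 \<le> max (l - s) (t - l) / 2" using st by auto
    fix i m j m' assume "(i, m) \<in> (\<lambda>i. (i, h i)) ` {..<n}" "(j, m') \<in> (\<lambda>i. (i, h i)) ` {..<n}"
    then have ij: "i < n" "j < n" "m = h i" "m' = h j" by auto
    then have m: "m \<in> mspace M" "m' \<in> mspace M" using h by (auto simp: bij_betw_def)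
    show "\<bar>mdist ?S i j - mdist M m m'\<bar> \<le> 2 * (max (l - s) (t - l) / 2)"
    proof (cases "i = j")
      case True
      then have "mdist M m m' = 0" using ij m by simp
      then show ?thesis using True l st by auto
    next
      case False
      then have "m \<noteq> m'" using ij h by (auto simp: bij_betw_def inj_on_def)
      then have "s \<le> mdist M m m'" "mdist M m m' \<le> t" using lo[OF m] hi[OF m] by auto
      then show ?thesis using False l by (auto simp: abs_le_iff le_max_iff_disj)
    qed
  qed
  then show "2 * gh_dist ?S M \<le> max (l - s) (t - l)" by simp
  have "max (l - s) (t - l) / 2 \<le> gh_dist ?S M"
  proof (rule gh_dist_ge[OF S(1) fin S(2,3)])
    fix R r assume R: "correspondence ?S M R"
      and dist: "\<And>x y x' y'. (x, y) \<in> R \<Longrightarrow> (x', y') \<in> R \<Longrightarrow>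
                   \<bar>mdist ?S x x' - mdist M y y'\<bar> < 2 * r"
    have *: "\<bar>l - mdist M x y\<bar> < 2 * r" if "x \<in> mspace M" "y \<in> mspace M" "x \<noteq> y" for x y
      by (rule max_deviation_le_of_correspondence[OF l fin card R _ that]) (rule dist)
    show "max (l - s) (t - l) / 2 \<le> r"
      using *[OF s(1,2,3)] *[OF t(1,2,3)] s(4) t(4) by (auto simp: max_def abs_less_iff)
  qed
  then show "max (l - s) (t - l) \<le> 2 * gh_dist ?S M" by simp
qed

section \<open>Spanning trees and edge exchange\<close>

lemma graph_path_sym:
  "(x, y) \<in> {(u, v). {u, v} \<in> E}\<^sup>* \<Longrightarrow> (y, x) \<in> {(u, v). {u, v} \<in> E}\<^sup>*"
  by (rule symD[OF sym_rtrancl]) (auto simp: sym_def insert_commute)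

lemma graph_connected_mono: "graph_connected V E \<Longrightarrow> E \<subseteq> F \<Longrightarrow> graph_connected V F"
proof -
  assume "graph_connected V E" "E \<subseteq> F"
  moreover from this have "{(u, v). {u, v} \<in> E}\<^sup>* \<subseteq> {(u, v). {u, v} \<in> F}\<^sup>*"
    by (intro rtrancl_mono) auto
  ultimately show ?thesis unfolding graph_connected_def by blast
qed

lemma crossing_edge:
  assumes "(s, v) \<in> {(u, v). {u, v} \<in> E}\<^sup>*" "s \<in> S" "v \<notin> S"
  shows "\<exists>a b. a \<in> S \<and> b \<notin> S \<and> {a, b} \<in> E"
  using assms by (induction rule: rtrancl_induct) blast+

text \<open>As long as \<open>S\<close> is not all of \<open>V\<close>, a path leaving \<open>S\<close> contains an edge with exactly one endpoint
  in \<open>S\<close>; adding it enlarges the connected part by one vertex and one edge. Starting from a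
  single vertex this produces a connected subgraph with one edge less than vertices; starting
  from a prescribed edge, one that contains this edge.\<close>

lemma grow_connected_subgraph:
  assumes "finite V" and "simple_graph V E" and "graph_connected V E"
    and "S \<subseteq> V" "S \<noteq> {}" "T \<subseteq> E" "T \<subseteq> Pow S" "graph_connected S T"
  shows "\<exists>F. T \<subseteq> F \<and> F \<subseteq> E \<and> graph_connected V F \<and> card F + card S = card T + card V"
  using assms(4-)
proof (induction "card (V - S)" arbitrary: S T)
  case 0
  then have "S = V" using \<open>finite V\<close> by auto
  then show ?case using 0 by auto
next
  case (Suc k)
  then obtain s v where "s \<in> S" "v \<in> V - S"
    by (metis all_not_in_conv card.empty nat.distinct(1))
  then obtain a b where ab: "a \<in> S" "b \<notin> S" "{a, b} \<in> E"
    using crossing_edge[of s v E S] assms(3) Suc.prems(1) by (auto simp: graph_connected_def)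
  then have b: "b \<in> V" using assms(2) by (auto simp: simple_graph_def doubleton_eq_iff)
  let ?T = "insert {a, b} T" and ?S = "insert b S"
  let ?R = "{(u, v). {u, v} \<in> ?T}"
  have fin: "finite S" "finite T"
    using \<open>finite V\<close> Suc.prems(1,4) by (auto intro: finite_subset)
  have to_a: "(x, a) \<in> ?R\<^sup>*" if "x \<in> ?S" for x
  proof (cases "x = b")
    case True
    then show ?thesis by (auto simp: insert_commute intro!: r_into_rtrancl)
  next
    case False
    then show ?thesis
      using graph_connected_mono[OF Suc.prems(5), of ?T] that ab(1)
      by (auto simp: graph_connected_def)
  qed
  then have "graph_connected ?S ?T"
    unfolding graph_connected_def using graph_path_sym[OF to_a] by (auto intro: rtrancl_trans)
  moreover have "k = card (V - ?S)"
    using Suc.hyps(2) b ab(2) \<open>finite V\<close>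
    by (metis Diff_insert card_Diff_singleton DiffI diff_Suc_1)
  ultimately have "\<exists>F. ?T \<subseteq> F \<and> F \<subseteq> E \<and> graph_connected V F \<and> card F + card ?S = card ?T + card V"
    using Suc.prems ab b by (intro Suc.hyps(1)) auto
  moreover have "{a, b} \<notin> T" using Suc.prems(4) ab(2) by blast
  ultimately show ?case using fin ab(2) by auto
qed

text \<open>A path that bypasses the edge \<open>{u, v}\<close> may be taken without repeated vertices. It then has
  at least three vertices, since its only shorter form is the forbidden edge, and the edge
  \<open>{u, v}\<close> closes it to a cycle.\<close>

lemma graph_cycle_of_path:
  assumes "(u, v) \<in> {(x, y). {x, y} \<in> E - {{u, v}}}\<^sup>*" and "{u, v} \<in> E" and "u \<noteq> v"
  shows "\<exists>p. graph_cycle E p"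
proof -
  let ?r = "\<lambda>x y. {x, y} \<in> E - {{u, v}}"
  have "?r\<^sup>*\<^sup>* u v" using assms(1) by (simp add: rtranclp_rtrancl_eq)
  then obtain xs where "rtrancl_path ?r u xs v"
    by (auto simp: rtranclp_eq_rtrancl_path)
  then obtain xs where xs: "rtrancl_path ?r u xs v" "distinct (u # xs)"
    by (rule rtrancl_path_distinct) blast
  have "xs \<noteq> []" using xs(1) assms(3) by (auto elim: rtrancl_path.cases)
  then have last: "last xs = v" using rtrancl_path_last[OF xs(1)] by simp
  have step: "?r ((u # xs) ! i) (xs ! i)" if "i < length xs" for i
    using rtrancl_path_nth[OF xs(1) that] .
  have "length xs \<noteq> 1"
  proof
    assume "length xs = 1"
    then have "xs = [v]" using last by (cases xs) auto
    then show False using step[of 0] by simp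
  qed
  with \<open>xs \<noteq> []\<close> have len: "length xs \<ge> 2" by (cases xs) (auto simp: Suc_le_eq)
  have "{(u # xs) ! i, (u # xs) ! (Suc i mod length (u # xs))} \<in> E" if "i < length (u # xs)" for i
  proof (cases "i < length xs")
    case True
    then show ?thesis using step[OF True] by simp
  next
    case False
    then have "i = length xs" using that by simp
    then have "(u # xs) ! i = v" "(u # xs) ! (Suc i mod length (u # xs)) = u"
      using \<open>xs \<noteq> []\<close> last by (auto simp: last_conv_nth nth_Cons')
    then show ?thesis using assms(2) by (simp add: insert_commute)
  qed
  then have "graph_cycle E (u # xs)" using len xs(2) by (auto simp: graph_cycle_def)
  then show ?thesis ..
qed

text \<open>The rest of the cycle is a detour around its first edge: every other edge of the cycle
  differs from it because the vertices of the cycle are distinct.\<close>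

lemma cycle_edge_removable:
  assumes "graph_connected V E" and p: "graph_cycle E p"
  shows "\<exists>e\<in>E. graph_connected V (E - {e})"
proof -
  have len: "length p \<ge> 3" and dist: "distinct p"
    and edge: "\<And>i. i < length p \<Longrightarrow> {p ! i, p ! (Suc i mod length p)} \<in> E"
    using p by (auto simp: graph_cycle_def)
  have pne: "p \<noteq> []" using len by auto
  have ne: "p ! i = p ! j \<longleftrightarrow> i = j" if "i < length p" "j < length p" for i j
    using that dist by (simp add: nth_eq_iff_index_eq)
  let ?e = "{p ! 0, p ! 1}"
  let ?R = "{(u, v). {u, v} \<in> E - {?e}}"
  have e: "?e \<in> E" using edge[of 0] len mod_less[of 1 "length p"] by fastforce
  have path: "(p ! 1, p ! Suc j) \<in> ?R\<^sup>*" if "Suc j < length p" for j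
    using that
  proof (induction j)
    case (Suc j)
    have "{p ! Suc j, p ! Suc (Suc j)} \<in> E" using edge[of "Suc j"] Suc.prems by simp
    moreover have "{p ! Suc j, p ! Suc (Suc j)} \<noteq> ?e"
      using ne[of "Suc j" 0] ne[of "Suc (Suc j)" 0] Suc.prems pne by (auto simp: doubleton_eq_iff)
    ultimately show ?case using Suc by (auto intro: rtrancl_into_rtrancl)
  qed simp
  have "(p ! 1, p ! (length p - 1)) \<in> ?R\<^sup>*" using path[of "length p - 2"] len
    by (simp add: Suc_diff_le numeral_2_eq_2 Suc_diff_Suc)
  moreover have "{p ! (length p - 1), p ! 0} \<in> E - {?e}"
  proof -
    have "Suc (length p - 1) = length p" using len by simp
    then have "Suc (length p - 1) mod length p = 0" by simp
    moreover have "p ! (length p - 1) \<noteq> p ! 1" "p ! (length p - 1) \<noteq> p ! 0"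
      using ne[of "length p - 1" 1] ne[of "length p - 1" 0] len pne by auto
    ultimately show ?thesis using edge[of "length p - 1"] len by (auto simp: doubleton_eq_iff)
  qed
  ultimately have detour: "(p ! 1, p ! 0) \<in> ?R\<^sup>*"
    by (auto intro: rtrancl_into_rtrancl)
  have "{(u, v). {u, v} \<in> E} \<subseteq> ?R\<^sup>*"
  proof clarify
    fix u v assume uv: "{u, v} \<in> E"
    show "(u, v) \<in> ?R\<^sup>*"
    proof (cases "{u, v} = ?e")
      case True
      then show ?thesis using detour graph_path_sym[OF detour] by (auto simp: doubleton_eq_iff)
    next
      case False
      then show ?thesis using uv by auto
    qed
  qed
  then have "{(u, v). {u, v} \<in> E}\<^sup>* \<subseteq> ?R\<^sup>*" by (rule rtrancl_subset_rtrancl)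
  then have "graph_connected V (E - {?e})"
    using assms(1) unfolding graph_connected_def by blast
  with e show ?thesis by blast
qed

lemma connected_subgraph_with_card:
  assumes "finite V" "V \<noteq> {}" "simple_graph V E" "graph_connected V E"
  shows "\<exists>F\<subseteq>E. graph_connected V F \<and> Suc (card F) = card V"
proof -
  obtain v where "v \<in> V" using assms(2) by blast
  then show ?thesis
    using grow_connected_subgraph[OF assms(1,3,4), of "{v}" "{}"]
    by (auto simp: graph_connected_def)
qed

lemma finite_simple_graph: "finite V \<Longrightarrow> simple_graph V E \<Longrightarrow> finite E"
  by (rule finite_subset[of _ "Pow V"]) (auto simp: simple_graph_def)

text \<open>An edge outside a connected subgraph with \<open>card V - 1\<close> edges would be bypassed by a path in
  that subgraph and hence close a cycle. So a tree equals that subgraph.\<close>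

lemma tree_on_card:
  assumes V: "finite V" "V \<noteq> {}" and E: "tree_on V E"
  shows "Suc (card E) = card V"
proof -
  have E': "simple_graph V E" "graph_connected V E" "\<nexists>p. graph_cycle E p"
    using E by (auto simp: tree_on_def)
  obtain F where F: "F \<subseteq> E" "graph_connected V F" "Suc (card F) = card V"
    using connected_subgraph_with_card[OF V E'(1,2)] by blast
  have "E \<subseteq> F"
  proof (rule ccontr)
    assume "\<not> E \<subseteq> F"
    then obtain e where e: "e \<in> E" "e \<notin> F" by blast
    then obtain u v where uv: "e = {u, v}" "u \<in> V" "v \<in> V" "u \<noteq> v"
      using E'(1) by (auto simp: simple_graph_def)
    have "graph_connected V (E - {e})" using F(1,2) e by (auto intro: graph_connected_mono)
    then have "(u, v) \<in> {(x, y). {x, y} \<in> E - {{u, v}}}\<^sup>*"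
      using uv by (auto simp: graph_connected_def)
    from graph_cycle_of_path[OF this] show False using E'(3) e uv by blast
  qed
  with F show ?thesis by auto
qed

text \<open>A cycle would allow an edge to be removed without losing connectedness, leaving fewer edges
  than any connected graph on \<open>V\<close> has.\<close>

lemma tree_onI_card:
  assumes V: "finite V" and E: "simple_graph V E" "graph_connected V E" "Suc (card E) = card V"
  shows "tree_on V E"
proof -
  have False if cycle: "graph_cycle E p" for p
  proof -
    obtain e where e: "e \<in> E" "graph_connected V (E - {e})"
      using cycle_edge_removable[OF E(2) cycle] by blast
    have fin: "finite E" by (rule finite_simple_graph[OF V E(1)])
    have "simple_graph V (E - {e})" using E(1) by (auto simp: simple_graph_def)
    moreover have "V \<noteq> {}" using E(3) by auto
    ultimately obtain F where F: "F \<subseteq> E - {e}" "Suc (card F) = card V"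
      using connected_subgraph_with_card[OF V] e(2) by metis
    have "card F \<le> card (E - {e})" using fin F(1) by (intro card_mono) auto
    also have "\<dots> < card E" using fin e(1) by (rule card_Diff1_less)
    finally show False using F(2) E(3) by simp
  qed
  with E show ?thesis by (auto simp: tree_on_def)
qed

text \<open>With \<open>{x, y}\<close> added there is one edge too many. Growing a connected subgraph from the new
  edge discards exactly one edge and keeps the new one, so the discarded edge is an
  old one. Counting edges replaces any discussion of which cycle has been closed.\<close>

lemma tree_exchange:
  assumes V: "finite V" and E: "tree_on V E" and xy: "x \<in> V" "y \<in> V" "x \<noteq> y" "{x, y} \<notin> E"
  shows "\<exists>f\<in>E. tree_on V (insert {x, y} (E - {f}))"
proof -
  let ?E = "insert {x, y} E"
  have E': "simple_graph V E" "graph_connected V E" using E by (auto simp: tree_on_def)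
  have fin: "finite E" by (rule finite_simple_graph[OF V E'(1)])
  have simple: "simple_graph V ?E" using E'(1) xy by (auto simp: simple_graph_def)
  have "graph_connected {x, y} {{x, y}}"
    by (auto simp: graph_connected_def insert_commute intro!: r_into_rtrancl)
  then obtain F where F: "{x, y} \<in> F" "F \<subseteq> ?E" "graph_connected V F"
      "card F + card {x, y} = card {{x, y}} + card V"
    using grow_connected_subgraph[OF V simple graph_connected_mono[OF E'(2)], of "{x, y}" "{{x, y}}"]
      xy by auto
  have card: "Suc (card F) = card V" using F(4) xy(3) by simp
  have cE: "Suc (card E) = card V" using tree_on_card[OF V _ E] xy by blast
  have "card (?E - F) = 1"
    using F(2) card cE fin xy(4) by (subst card_Diff_subset) (auto intro: finite_subset)
  then obtain f where f: "?E - F = {f}" by (auto simp: card_1_singleton_iff)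
  then have "f \<in> E" "F = insert {x, y} (E - {f})" using F(1,2) by auto
  moreover have "simple_graph V F"
    using simple F(2) unfolding simple_graph_def by (rule order_trans[rotated])
  then have "tree_on V F" by (rule tree_onI_card[OF V _ F(3) card])
  ultimately show ?thesis by blast
qed

lemma graph_length_exchange:
  assumes "finite E" "f \<in> E" "{x, y} \<notin> E"
  shows "graph_length M (insert {x, y} (E - {f})) = graph_length M E - edge_length M f + mdist M x y"
  using assms by (simp add: graph_length_def sum_diff1)

text \<open>Unless \<open>{x, y}\<close> is itself an edge of the tree, some edge can be exchanged for it, and by
  minimality that edge is not longer.\<close>

lemma minimum_spanning_tree_short_edge:
  assumes fin: "finite (mspace M)" and E: "minimum_spanning_tree M E"
    and xy: "x \<in> mspace M" "y \<in> mspace M" "x \<noteq> y"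
  shows "\<exists>e\<in>E. edge_length M e \<le> mdist M x y"
proof (cases "{x, y} \<in> E")
  case True
  then show ?thesis by (intro bexI[of _ "{x, y}"]) auto
next
  case False
  have T: "tree_on (mspace M) E" using E by (simp add: minimum_spanning_tree_def)
  obtain f where f: "f \<in> E" "tree_on (mspace M) (insert {x, y} (E - {f}))"
    using tree_exchange[OF fin T xy False] by blast
  have "finite E" using T finite_simple_graph[OF fin] by (auto simp: tree_on_def)
  with E f graph_length_exchange[of E f x y M] False show ?thesis
    by (force simp: minimum_spanning_tree_def)
qed

lemma maximum_spanning_tree_long_edge:
  assumes fin: "finite (mspace M)" and E: "maximum_spanning_tree M E"
    and xy: "x \<in> mspace M" "y \<in> mspace M" "x \<noteq> y"
  shows "\<exists>e\<in>E. mdist M x y \<le> edge_length M e"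
proof (cases "{x, y} \<in> E")
  case True
  then show ?thesis by (intro bexI[of _ "{x, y}"]) auto
next
  case False
  have T: "tree_on (mspace M) E" using E by (simp add: maximum_spanning_tree_def)
  obtain f where f: "f \<in> E" "tree_on (mspace M) (insert {x, y} (E - {f}))"
    using tree_exchange[OF fin T xy False] by blast
  have "finite E" using T finite_simple_graph[OF fin] by (auto simp: tree_on_def)
  with E f graph_length_exchange[of E f x y M] False show ?thesis
    by (force simp: maximum_spanning_tree_def)
qed

section \<open>Extreme entries of the spectra\<close>

lemma tree_edge_endpoints:
  assumes "tree_on (mspace M) E" "e \<in> E"
  shows "\<exists>x y. x \<in> mspace M \<and> y \<in> mspace M \<and> x \<noteq> y \<and> edge_length M e = mdist M x y"
proof -
  obtain x y where "e = {x, y}" "x \<in> mspace M" "y \<in> mspace M" "x \<noteq> y"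
    using assms by (auto simp: tree_on_def simple_graph_def)
  then show ?thesis by (metis edge_length_eq)
qed

lemma sorted_edge_lengths_tree:
  assumes fin: "finite (mspace M)" "2 \<le> card (mspace M)" and E: "tree_on (mspace M) E"
  shows "sorted (sorted_edge_lengths M E)"
    and "length (sorted_edge_lengths M E) = card (mspace M) - 1"
    and "set (sorted_edge_lengths M E) = edge_length M ` E"
proof -
  have "finite E" using E finite_simple_graph[OF fin(1)] by (auto simp: tree_on_def)
  moreover have "mspace M \<noteq> {}" using fin(2) by force
  then have "Suc (card E) = card (mspace M)" by (rule tree_on_card[OF fin(1) _ E])
  ultimately show "sorted (sorted_edge_lengths M E)"
    "length (sorted_edge_lengths M E) = card (mspace M) - 1"
    "set (sorted_edge_lengths M E) = edge_length M ` E"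
    by (simp_all add: sorted_edge_lengths_def flip: size_mset set_mset_mset)
qed

text \<open>The \<open>mst\<close>-spectrum is descending, so its last entry is the first entry of the
  ascending list of edge lengths. It is attained by an edge, and no distance is smaller because
  every distance dominates the length of some edge of the tree.\<close>

lemma mst_spectrum_last:
  assumes fin: "finite (mspace M)" and n: "card (mspace M) = n" "2 \<le> n"
    and \<sigma>: "is_mst_spectrum M \<sigma>"
  shows "\<exists>x\<in>mspace M. \<exists>y\<in>mspace M. x \<noteq> y \<and> mdist M x y = \<sigma> ! (n - 2)"
    and "x \<in> mspace M \<Longrightarrow> y \<in> mspace M \<Longrightarrow> x \<noteq> y \<Longrightarrow> \<sigma> ! (n - 2) \<le> mdist M x y"
proof -
  obtain E where E: "minimum_spanning_tree M E" and \<sigma>_eq: "\<sigma> = rev (sorted_edge_lengths M E)"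
    using \<sigma> by (auto simp: is_mst_spectrum_def)
  then have T: "tree_on (mspace M) E" by (simp add: minimum_spanning_tree_def)
  let ?L = "sorted_edge_lengths M E"
  have L: "sorted ?L" "length ?L = n - 1" "set ?L = edge_length M ` E"
    using sorted_edge_lengths_tree[OF fin _ T] n by auto
  have eq: "\<sigma> ! (n - 2) = ?L ! 0" using n(2) L(2) by (simp add: \<sigma>_eq rev_nth)
  have "?L ! 0 \<in> edge_length M ` E" using L n(2) nth_mem[of 0 ?L] by simp
  then show "\<exists>x\<in>mspace M. \<exists>y\<in>mspace M. x \<noteq> y \<and> mdist M x y = \<sigma> ! (n - 2)"
    using tree_edge_endpoints[OF T] eq by force
  assume "x \<in> mspace M" "y \<in> mspace M" "x \<noteq> y"
  then obtain e where e: "e \<in> E" "edge_length M e \<le> mdist M x y"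
    using minimum_spanning_tree_short_edge[OF fin E] by blast
  then obtain i where "i < length ?L" "?L ! i = edge_length M e"
    using L(3) by (metis imageI in_set_conv_nth)
  then have "?L ! 0 \<le> edge_length M e" using sorted_nth_mono[OF L(1), of 0 i] by simp
  with e eq show "\<sigma> ! (n - 2) \<le> mdist M x y" by simp
qed

lemma xst_spectrum_last:
  assumes fin: "finite (mspace M)" and n: "card (mspace M) = n" "2 \<le> n"
    and \<Sigma>: "is_xst_spectrum M \<Sigma>"
  shows "\<exists>x\<in>mspace M. \<exists>y\<in>mspace M. x \<noteq> y \<and> mdist M x y = \<Sigma> ! (n - 2)"
    and "x \<in> mspace M \<Longrightarrow> y \<in> mspace M \<Longrightarrow> mdist M x y \<le> \<Sigma> ! (n - 2)"
proof -
  obtain E where E: "maximum_spanning_tree M E" and \<Sigma>_eq: "\<Sigma> = sorted_edge_lengths M E"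
    using \<Sigma> by (auto simp: is_xst_spectrum_def)
  then have T: "tree_on (mspace M) E" by (simp add: maximum_spanning_tree_def)
  have L: "sorted \<Sigma>" "length \<Sigma> = n - 1" "set \<Sigma> = edge_length M ` E"
    using sorted_edge_lengths_tree[OF fin _ T] n \<Sigma>_eq by auto
  have "\<Sigma> ! (n - 2) \<in> edge_length M ` E" using L n(2) nth_mem[of "n - 2" \<Sigma>] by simp
  then obtain u v where uv: "u \<in> mspace M" "v \<in> mspace M" "u \<noteq> v" "mdist M u v = \<Sigma> ! (n - 2)"
    using tree_edge_endpoints[OF T] by force
  then show "\<exists>x\<in>mspace M. \<exists>y\<in>mspace M. x \<noteq> y \<and> mdist M x y = \<Sigma> ! (n - 2)" by blast
  assume xy: "x \<in> mspace M" "y \<in> mspace M"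
  show "mdist M x y \<le> \<Sigma> ! (n - 2)"
  proof (cases "x = y")
    case True
    then have "mdist M x y = 0" using xy by simp
    then show ?thesis using uv(4) mdist_nonneg[of M u v] by simp
  next
    case False
    then obtain e where e: "e \<in> E" "mdist M x y \<le> edge_length M e"
      using maximum_spanning_tree_long_edge[OF fin E] xy by blast
    then obtain i where "i < length \<Sigma>" "\<Sigma> ! i = edge_length M e"
      using L(3) by (metis imageI in_set_conv_nth)
    then have "edge_length M e \<le> \<Sigma> ! (n - 2)" using sorted_nth_mono[OF L(1), of i "n - 2"] L(2) by simp
    with e show ?thesis by simp
  qed
qed

theorem theorem4p8:
  fixes M :: "'a metric" and n :: nat and \<sigma> \<Sigma> :: "real list" and l :: real
  assumes "finite (mspace M)" and "card (mspace M) = n" and "n \<ge> 2"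
    and "is_mst_spectrum M \<sigma>" and "is_xst_spectrum M \<Sigma>"
    and "l > 0"
  shows
    "2 * gh_dist (simplex_metric l n) M = max (l - \<sigma> ! (n - 2)) (\<Sigma> ! (n - 2) - l) \<and>
     max (l - \<sigma> ! (n - 2)) (\<Sigma> ! (n - 2) - l) = max (l - min_separation M) (mdiameter M - l) \<and>
     (\<sigma> ! (n - 2) + \<Sigma> ! (n - 2) \<le> 2 * l \<longrightarrow>
        2 * gh_dist (simplex_metric l n) M = l - \<sigma> ! (n - 2)) \<and>
     (\<not> \<sigma> ! (n - 2) + \<Sigma> ! (n - 2) \<le> 2 * l \<longrightarrow>
        2 * gh_dist (simplex_metric l n) M = \<Sigma> ! (n - 2) - l)"
proof -
  let ?s = "\<sigma> ! (n - 2)" and ?t = "\<Sigma> ! (n - 2)"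
  note s = mst_spectrum_last[OF assms(1,2,3,4)] and t = xst_spectrum_last[OF assms(1,2,3,5)]
  obtain a b where ab: "a \<in> mspace M" "b \<in> mspace M" "a \<noteq> b" "mdist M a b = ?s"
    using s(1) by blast
  obtain c d where cd: "c \<in> mspace M" "d \<in> mspace M" "c \<noteq> d" "mdist M c d = ?t"
    using t(1) by blast
  have gh: "2 * gh_dist (simplex_metric l n) M = max (l - ?s) (?t - l)"
    by (rule gh_dist_simplex_eq[OF assms(1,2,6) s(2) t(2) ab cd])
  have "min_separation M = ?s"
    unfolding min_separation_def by (rule cInf_eq_minimum) (use ab s(2) in force)+
  moreover have "mdiameter M = ?t"
    unfolding mdiameter_def by (rule cSup_eq_maximum) (use cd t(2) in force)+
  ultimately show ?thesis using gh by auto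
qed

end
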